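(* For a topological space $X$ the following assertions are equivalent: (1) $X$ is Scheepers; (2) the Alexandroff duplicate $AD(X)$ is Scheepers; (3) $AD(X)$ is weakly Scheepers in the sense of Kočinac.
   Context: The Alexandroff duplicate $AD(X)$ of a space $X$ is the set $X\times\{0,1\}$ topologized as follows: each point of $X\times\{1\}$ is isolated, and a basic neighbourhood of $(x,0)$ is a set of the form $(U\times\{0\})\cup\left((U\times\{1\})\setminus\{(x,1)\}\right)$, where $U$ is a neighbourhood of $x$ in $X$. A space $Z$ is Scheepers if for every sequence $(\mathcal{U}_n)_{n\in\mathbb{N}}$ of open covers of $Z$ there are finite $\mathcal{V}_n\subseteq\mathcal{U}_n$ such that every finite set $F\subseteq Z$ is contained in $\bigcup\mathcal{V}_n$ for some $n$. $Z$ is weakly Scheepers in the sense of Kočinac if for every sequence $(\mathcal{U}_n)_{n\in\mathbb{N}}$ of open covers of $Z$ there are a dense set $Y\subseteq Z$ and finite $\mathcal{V}_n\subseteq\mathcal{U}_n$ such that every finite set $F\subseteq Y$ is contained in $\bigcup\mathcal{V}_n$ for some $n$. *)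

theory Defs
  imports "HOL-Analysis.Analysis"
begin

definition open_cover :: "'a topology \<Rightarrow> 'a set set \<Rightarrow> bool" where
  "open_cover X \<U> \<longleftrightarrow> (\<forall>U\<in>\<U>. openin X U) \<and> \<Union>\<U> = topspace X"

definition scheepers_space :: "'a topology \<Rightarrow> bool" where
  "scheepers_space X \<longleftrightarrow>
     (\<forall>\<U> :: nat \<Rightarrow> 'a set set. (\<forall>n. open_cover X (\<U> n)) \<longrightarrow>
        (\<exists>\<V> :: nat \<Rightarrow> 'a set set.
           (\<forall>n. finite (\<V> n) \<and> \<V> n \<subseteq> \<U> n) \<and>
           (\<forall>F. finite F \<and> F \<subseteq> topspace X \<longrightarrow> (\<exists>n. F \<subseteq> \<Union>(\<V> n)))))"

definition weakly_scheepers_space :: "'a topology \<Rightarrow> bool" where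
  "weakly_scheepers_space X \<longleftrightarrow>
     (\<forall>\<U> :: nat \<Rightarrow> 'a set set. (\<forall>n. open_cover X (\<U> n)) \<longrightarrow>
        (\<exists>Y (\<V> :: nat \<Rightarrow> 'a set set).
           Y \<subseteq> topspace X \<and> X closure_of Y = topspace X \<and>
           (\<forall>n. finite (\<V> n) \<and> \<V> n \<subseteq> \<U> n) \<and>
           (\<forall>F. finite F \<and> F \<subseteq> Y \<longrightarrow> (\<exists>n. F \<subseteq> \<Union>(\<V> n)))))"

definition ad_basic_nhd :: "'a set \<Rightarrow> 'a \<Rightarrow> ('a \<times> nat) set" where
  "ad_basic_nhd U x = (U \<times> {0}) \<union> ((U \<times> {1}) - {(x, 1)})"

(* The topology determined by the assigned basic neighbourhoods: a set is open iff with each of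
   its points it contains a basic neighbourhood of that point.  A point (x, 1) has the basic
   neighbourhood {(x, 1)} and so imposes no condition.  No separation axiom is assumed; for a
   T1 space the assigned sets are themselves open (openin_ad_basic_nhd). *)
definition alexandroff_duplicate :: "'a topology \<Rightarrow> ('a \<times> nat) topology" where
  "alexandroff_duplicate X = topology (\<lambda>W. W \<subseteq> topspace X \<times> {0, 1} \<and>
     (\<forall>x. (x, 0) \<in> W \<longrightarrow> (\<exists>U. openin X U \<and> x \<in> U \<and> ad_basic_nhd U x \<subseteq> W)))"

lemma openin_alexandroff_duplicate:
  "openin (alexandroff_duplicate X) W \<longleftrightarrow> W \<subseteq> topspace X \<times> {0, 1} \<and>
     (\<forall>x. (x, 0) \<in> W \<longrightarrow> (\<exists>U. openin X U \<and> x \<in> U \<and> ad_basic_nhd U x \<subseteq> W))"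
proof -
  let ?P = "\<lambda>W. W \<subseteq> topspace X \<times> {0, 1} \<and>
     (\<forall>x. (x, 0) \<in> W \<longrightarrow> (\<exists>U. openin X U \<and> x \<in> U \<and> ad_basic_nhd U x \<subseteq> W))"
  have "istopology ?P"
    unfolding istopology_def
  proof (intro conjI allI impI)
    fix S T assume S: "?P S" and T: "?P T"
    show "S \<inter> T \<subseteq> topspace X \<times> {0, 1}" using S by blast
    fix x assume x: "(x, 0) \<in> S \<inter> T"
    obtain U where U: "openin X U" "x \<in> U" "ad_basic_nhd U x \<subseteq> S" using S x by blast
    obtain V where V: "openin X V" "x \<in> V" "ad_basic_nhd V x \<subseteq> T" using T x by blast
    have "ad_basic_nhd (U \<inter> V) x \<subseteq> S \<inter> T"
      using U(3) V(3) unfolding ad_basic_nhd_def by blast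
    then show "\<exists>W. openin X W \<and> x \<in> W \<and> ad_basic_nhd W x \<subseteq> S \<inter> T"
      using U V by blast
  next
    fix \<K> assume K: "\<forall>K\<in>\<K>. ?P K"
    show "\<Union>\<K> \<subseteq> topspace X \<times> {0, 1}" using K by blast
    fix x assume "(x, 0) \<in> \<Union>\<K>"
    then obtain K where "K \<in> \<K>" "(x, 0) \<in> K" by blast
    then show "\<exists>U. openin X U \<and> x \<in> U \<and> ad_basic_nhd U x \<subseteq> \<Union>\<K>"
      using K by (meson Union_upper subset_trans)
  qed
  then show ?thesis
    by (simp add: alexandroff_duplicate_def topology_inverse')
qed

lemma topspace_alexandroff_duplicate [simp]:
  "topspace (alexandroff_duplicate X) = topspace X \<times> {0, 1}"
proof
  show "topspace (alexandroff_duplicate X) \<subseteq> topspace X \<times> {0, 1}"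
    using openin_topspace openin_alexandroff_duplicate by blast
  have "openin (alexandroff_duplicate X) (topspace X \<times> {0, 1})"
    unfolding openin_alexandroff_duplicate ad_basic_nhd_def by auto
  then show "topspace X \<times> {0, 1} \<subseteq> topspace (alexandroff_duplicate X)"
    by (rule openin_subset)
qed

lemma openin_ad_isolated:
  "x \<in> topspace X \<Longrightarrow> openin (alexandroff_duplicate X) {(x, 1)}"
  unfolding openin_alexandroff_duplicate by auto

lemma openin_ad_basic_nhd:
  assumes "t1_space X" "openin X U" "x \<in> U"
  shows "openin (alexandroff_duplicate X) (ad_basic_nhd U x)"
  unfolding openin_alexandroff_duplicate
proof (intro conjI allI impI)
  show "ad_basic_nhd U x \<subseteq> topspace X \<times> {0, 1}"
    using openin_subset[OF assms(2)] unfolding ad_basic_nhd_def by blast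
  fix y assume "(y, 0) \<in> ad_basic_nhd U x"
  then have y: "y \<in> U" by (auto simp: ad_basic_nhd_def)
  show "\<exists>V. openin X V \<and> y \<in> V \<and> ad_basic_nhd V y \<subseteq> ad_basic_nhd U x"
  proof (cases "y = x")
    case True
    then show ?thesis using assms by blast
  next
    case False
    have "openin X (U - {x})"
      using assms by (metis closedin_t1_singleton in_mono openin_diff openin_subset)
    moreover have "ad_basic_nhd (U - {x}) y \<subseteq> ad_basic_nhd U x"
      unfolding ad_basic_nhd_def by blast
    ultimately show ?thesis using y False by blast
  qed
qed

end

theory Submission
  imports Defs
begin

text \<open>Every dense subset of \<open>AD(X)\<close> contains the isolated points \<open>X \<times> {1}\<close>, so the weak property of
  \<open>AD(X)\<close>, applied to the covers \<open>{U \<times> {0,1}. U \<in> \<U>\<^sub>n}\<close>, gives the Scheepers property of \<open>X\<close>.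
  Conversely, a cover of \<open>AD(X)\<close> is refined at the points \<open>(x, 0)\<close> by basic neighbourhoods, whose
  traces \<open>U\<^sub>x\<close> cover \<open>X\<close>. Finitely many basic neighbourhoods cover the part of \<open>AD(X)\<close> over the
  union of their traces up to the finitely many points \<open>(x, 1)\<close>, and these can be covered
  by finitely many further members.\<close>

lemma scheepers_spaceD:
  assumes "scheepers_space X" "\<forall>n. open_cover X (\<U> n)"
  shows "\<exists>\<V> :: nat \<Rightarrow> 'a set set. (\<forall>n. finite (\<V> n) \<and> \<V> n \<subseteq> \<U> n) \<and>
    (\<forall>F. finite F \<and> F \<subseteq> topspace X \<longrightarrow> (\<exists>n. F \<subseteq> \<Union>(\<V> n)))"
  by (rule assms(1)[unfolded scheepers_space_def, THEN spec, THEN mp, OF assms(2)])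

lemma weakly_scheepers_spaceD:
  assumes "weakly_scheepers_space X" "\<forall>n. open_cover X (\<U> n)"
  shows "\<exists>Y (\<V> :: nat \<Rightarrow> 'a set set). Y \<subseteq> topspace X \<and> X closure_of Y = topspace X \<and>
    (\<forall>n. finite (\<V> n) \<and> \<V> n \<subseteq> \<U> n) \<and> (\<forall>F. finite F \<and> F \<subseteq> Y \<longrightarrow> (\<exists>n. F \<subseteq> \<Union>(\<V> n)))"
  by (rule assms(1)[unfolded weakly_scheepers_space_def, THEN spec, THEN mp, OF assms(2)])

text \<open>The whole space serves as the dense set.\<close>

lemma scheepers_imp_weakly_scheepers:
  assumes "scheepers_space X"
  shows "weakly_scheepers_space X"
  unfolding weakly_scheepers_space_def
proof (intro allI impI)
  fix \<U> :: "nat \<Rightarrow> 'a set set" assume \<U>: "\<forall>n. open_cover X (\<U> n)"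
  obtain \<V> where "\<forall>n. finite (\<V> n) \<and> \<V> n \<subseteq> \<U> n"
    "\<forall>F. finite F \<and> F \<subseteq> topspace X \<longrightarrow> (\<exists>n. F \<subseteq> \<Union>(\<V> n))"
    using scheepers_spaceD[OF assms \<U>] by (elim exE conjE)
  then show "\<exists>Y \<V>. Y \<subseteq> topspace X \<and> X closure_of Y = topspace X \<and>
      (\<forall>n. finite (\<V> n) \<and> \<V> n \<subseteq> \<U> n) \<and> (\<forall>F. finite F \<and> F \<subseteq> Y \<longrightarrow> (\<exists>n. F \<subseteq> \<Union>(\<V> n)))"
    by (intro exI[of _ "topspace X"] exI[of _ \<V>]) simp
qed

text \<open>The open set \<open>{x}\<close> has to meet \<open>Y\<close>, and it can do so only in
  \<open>x\<close>.\<close>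

lemma isolated_in_dense:
  assumes "X closure_of Y = topspace X" "openin X {x}"
  shows "x \<in> Y"
proof -
  have "x \<in> X closure_of Y" using assms openin_subset by blast
  then show ?thesis using assms(2) by (auto simp: in_closure_of)
qed

text \<open>At each point of the bottom level, \<open>U\<close> itself is a witness, since deleting
  a point from the upper copy leaves the basic neighbourhood inside the cylinder.\<close>

lemma openin_ad_cylinder:
  assumes "openin X U"
  shows "openin (alexandroff_duplicate X) (U \<times> {0, 1})"
  unfolding openin_alexandroff_duplicate
proof (intro conjI allI impI)
  show "U \<times> {0, 1} \<subseteq> topspace X \<times> {0, 1}" using openin_subset[OF assms] by blast
  fix x assume "(x, 0) \<in> U \<times> {0, 1 :: nat}"
  moreover have "ad_basic_nhd U x \<subseteq> U \<times> {0, 1}" unfolding ad_basic_nhd_def by blast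
  ultimately show "\<exists>V. openin X V \<and> x \<in> V \<and> ad_basic_nhd V x \<subseteq> U \<times> {0, 1}"
    using assms by blast
qed

lemma open_cover_ad_cylinders:
  assumes "open_cover X \<U>"
  shows "open_cover (alexandroff_duplicate X) ((\<lambda>U. U \<times> {0, 1}) ` \<U>)"
proof -
  have "\<Union>((\<lambda>U. U \<times> {0, 1 :: nat}) ` \<U>) = \<Union>\<U> \<times> {0, 1}" by blast
  then show ?thesis using assms by (simp add: open_cover_def openin_ad_cylinder del: One_nat_def)
qed

lemma weakly_scheepers_ad_imp_scheepers:
  assumes "weakly_scheepers_space (alexandroff_duplicate X)"
  shows "scheepers_space X"
  unfolding scheepers_space_def
proof (intro allI impI)
  fix \<U> :: "nat \<Rightarrow> 'a set set" assume \<U>: "\<forall>n. open_cover X (\<U> n)"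
  let ?AD = "alexandroff_duplicate X" and ?cyl = "\<lambda>U :: 'a set. U \<times> {0, 1 :: nat}"
  have "\<forall>n. open_cover ?AD (?cyl ` \<U> n)"
    using \<U> by (intro allI open_cover_ad_cylinders) (rule spec)
  from weakly_scheepers_spaceD[OF assms this] obtain Y \<W>
    where Y: "?AD closure_of Y = topspace ?AD"
    and \<W>: "\<forall>n. finite (\<W> n) \<and> \<W> n \<subseteq> ?cyl ` \<U> n"
    and F: "\<forall>F. finite F \<and> F \<subseteq> Y \<longrightarrow> (\<exists>n. F \<subseteq> \<Union>(\<W> n))"
    by (elim exE conjE)
  \<comment> \<open>The selected cylinders are traced back to finitely many bases in
    \<open>\<U> n\<close>.\<close>
  have "\<exists>\<V> \<subseteq> \<U> n. finite \<V> \<and> \<W> n = ?cyl ` \<V>" for n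
    using \<W> by (intro finite_subset_image) simp_all
  then obtain \<V> where \<V>: "\<And>n. \<V> n \<subseteq> \<U> n" "\<And>n. finite (\<V> n)" "\<And>n. \<W> n = ?cyl ` \<V> n"
    by metis
  have "\<exists>n. G \<subseteq> \<Union>(\<V> n)" if G: "finite G" "G \<subseteq> topspace X" for G
  proof -
    \<comment> \<open>The unknown dense set may miss points of the bottom level, so \<open>G\<close>
      is tested through its copy on the isolated level.\<close>
    have "G \<times> {1} \<subseteq> Y"
      using isolated_in_dense[OF Y openin_ad_isolated] G(2) by blast
    then obtain n where "G \<times> {1} \<subseteq> \<Union>(\<W> n)"
      using F[THEN spec, of "G \<times> {1}"] G(1) by auto
    then have "G \<subseteq> \<Union>(\<V> n)" unfolding \<V>(3) by blast
    then show ?thesis ..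
  qed
  then show "\<exists>\<V>. (\<forall>n. finite (\<V> n) \<and> \<V> n \<subseteq> \<U> n) \<and>
      (\<forall>F. finite F \<and> F \<subseteq> topspace X \<longrightarrow> (\<exists>n. F \<subseteq> \<Union>(\<V> n)))"
    using \<V> by (intro exI[of _ \<V>]) simp
qed

text \<open>All choices are indexed by the centre \<open>x\<close>, so that finitely many centres
  determine finitely many members of \<open>\<W>\<close>. The member \<open>W' x\<close> takes care
  of \<open>(x, 1)\<close>, the one point over \<open>U x\<close> that \<open>W x\<close> may
  miss.\<close>

lemma open_cover_ad_refinement:
  assumes "open_cover (alexandroff_duplicate X) \<W>"
  obtains U W W' where "open_cover X (U ` topspace X)"
    "\<And>x. x \<in> topspace X \<Longrightarrow> ad_basic_nhd (U x) x \<subseteq> W x"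
    "\<And>x. x \<in> topspace X \<Longrightarrow> (x, 1) \<in> W' x"
    "W ` topspace X \<subseteq> \<W>" "W' ` topspace X \<subseteq> \<W>"
proof -
  have un: "\<Union>\<W> = topspace X \<times> {0, 1}"
    using assms by (simp add: open_cover_def)
  have "\<forall>x\<in>topspace X. \<exists>U W. openin X U \<and> x \<in> U \<and> W \<in> \<W> \<and> ad_basic_nhd U x \<subseteq> W"
  proof
    fix x assume "x \<in> topspace X"
    then obtain W where W: "W \<in> \<W>" "(x, 0) \<in> W" using un by blast
    then have "openin (alexandroff_duplicate X) W" using assms by (simp add: open_cover_def)
    then have "\<exists>U. openin X U \<and> x \<in> U \<and> ad_basic_nhd U x \<subseteq> W"
      using W(2) by (simp add: openin_alexandroff_duplicate)
    then show "\<exists>U W. openin X U \<and> x \<in> U \<and> W \<in> \<W> \<and> ad_basic_nhd U x \<subseteq> W"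
      using W(1) by blast
  qed
  then obtain U W where UW: "\<forall>x\<in>topspace X. openin X (U x) \<and> x \<in> U x \<and> W x \<in> \<W> \<and>
      ad_basic_nhd (U x) x \<subseteq> W x"
    by metis
  have "\<forall>x\<in>topspace X. \<exists>W'\<in>\<W>. (x, 1) \<in> W'" using un by blast
  then obtain W' where W': "\<forall>x\<in>topspace X. W' x \<in> \<W> \<and> (x, 1) \<in> W' x" by metis
  have "open_cover X (U ` topspace X)"
    using UW openin_subset unfolding open_cover_def by blast
  then show thesis by (rule that[of U W W']) (use UW W' in auto)
qed

lemma scheepers_imp_scheepers_ad:
  assumes "scheepers_space X"
  shows "scheepers_space (alexandroff_duplicate X)"
  unfolding scheepers_space_def
proof (intro allI impI)
  fix \<W> :: "nat \<Rightarrow> ('a \<times> nat) set set"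
  let ?AD = "alexandroff_duplicate X"
  assume \<W>: "\<forall>n. open_cover ?AD (\<W> n)"
  have "\<exists>U W W'. open_cover X (U ` topspace X) \<and>
      (\<forall>x\<in>topspace X. ad_basic_nhd (U x) x \<subseteq> W x) \<and> (\<forall>x\<in>topspace X. (x, 1) \<in> W' x) \<and>
      W ` topspace X \<subseteq> \<W> n \<and> W' ` topspace X \<subseteq> \<W> n" for n
    by (rule open_cover_ad_refinement[OF spec[OF \<W>, of n]]) blast
  then obtain U W W' where cover: "\<forall>n. open_cover X (U n ` topspace X)"
    and W: "\<And>n x. x \<in> topspace X \<Longrightarrow> ad_basic_nhd (U n x) x \<subseteq> W n x"
    and W': "\<And>n x. x \<in> topspace X \<Longrightarrow> (x, 1) \<in> W' n x"
    and sub: "\<And>n. W n ` topspace X \<subseteq> \<W> n" "\<And>n. W' n ` topspace X \<subseteq> \<W> n"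
    by metis
  obtain \<V> where \<V>: "\<forall>n. finite (\<V> n) \<and> \<V> n \<subseteq> U n ` topspace X"
    and F: "\<forall>F. finite F \<and> F \<subseteq> topspace X \<longrightarrow> (\<exists>n. F \<subseteq> \<Union>(\<V> n))"
    using scheepers_spaceD[OF assms cover] by (elim exE conjE)
  \<comment> \<open>Different centres may have the same trace. Since the omitted point depends on
    the centre, a finite set of centres is fixed for the selected traces.\<close>
  have "\<exists>A \<subseteq> topspace X. finite A \<and> \<V> n = U n ` A" for n
    using \<V> by (intro finite_subset_image) simp_all
  then obtain A where A: "\<And>n. A n \<subseteq> topspace X" "\<And>n. finite (A n)" "\<And>n. \<V> n = U n ` A n"
    by metis
  define \<S> where "\<S> n = W n ` A n \<union> W' n ` A n" for n
  have "finite (\<S> n) \<and> \<S> n \<subseteq> \<W> n" for n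
    using A(1,2)[of n] sub[of n] unfolding \<S>_def by blast
  moreover have "\<exists>n. G \<subseteq> \<Union>(\<S> n)" if G: "finite G" "G \<subseteq> topspace ?AD" for G
  proof -
    \<comment> \<open>The Scheepers property of \<open>X\<close> is applied to the projection of
      \<open>G\<close>, which is again finite.\<close>
    obtain n where n: "fst ` G \<subseteq> \<Union>(U n ` A n)"
      using F[THEN spec, of "fst ` G"] G A(3) by auto
    have "p \<in> \<Union>(\<S> n)" if pG: "p \<in> G" for p
    proof -
      obtain y i where p: "p = (y, i)" "i = 0 \<or> i = 1" using G(2) pG by auto
      obtain x where x: "x \<in> A n" "y \<in> U n x" using n pG p(1) by force
      have "x \<in> topspace X" using A(1) x(1) by blast
      note in_W = W[OF this, of n] and in_W' = W'[OF this, of n]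
      \<comment> \<open>The basic neighbourhood at \<open>x\<close> contains \<open>p\<close> unless
        \<open>p = (x, 1)\<close>, and that point lies in \<open>W' n x\<close>.\<close>
      have "p \<in> W n x \<or> p \<in> W' n x"
        using in_W in_W' x(2) p by (cases "y = x") (auto simp: ad_basic_nhd_def)
      then show ?thesis using x(1) unfolding \<S>_def by blast
    qed
    then show ?thesis by blast
  qed
  ultimately show "\<exists>\<V>. (\<forall>n. finite (\<V> n) \<and> \<V> n \<subseteq> \<W> n) \<and>
      (\<forall>F. finite F \<and> F \<subseteq> topspace ?AD \<longrightarrow> (\<exists>n. F \<subseteq> \<Union>(\<V> n)))"
    by blast
qed

theorem theorem4p1:
  fixes X :: "'a topology"
  shows "(scheepers_space X \<longleftrightarrow> scheepers_space (alexandroff_duplicate X)) \<and>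
         (scheepers_space (alexandroff_duplicate X) \<longleftrightarrow>
            weakly_scheepers_space (alexandroff_duplicate X))"
  \<comment> \<open>The three implications close the cycle from \<open>X\<close> Scheepers to
    \<open>AD(X)\<close> Scheepers to \<open>AD(X)\<close> weakly Scheepers and back.\<close>
  using scheepers_imp_scheepers_ad scheepers_imp_weakly_scheepers
    weakly_scheepers_ad_imp_scheepers by blast

end
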